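(* Let $G$ be a group and let $\gamma$ be an anti-automorphism of $G$. Then $G$ is chiral if and only if $G$ is $\gamma$-chiral.
   Context: Let $F_d$ denote the free group with basis $x_1,\ldots,x_d$. For a group $G$ and a word $w\in F_d$, the word map $w:G^d\to G$ is the evaluation map sending $(g_1,\ldots,g_d)$ to $w(g_1,\ldots,g_d)$, the image of $w$ under the homomorphism $F_d\to G$ with $x_i\mapsto g_i$. An anti-automorphism of a group $G$ is a bijection $\delta:G\to G$ such that $\delta(ab)=\delta(b)\delta(a)$ for all $a,b\in G$. For an anti-automorphism $\gamma$ of $G$ and a word $w\in F_d$, define $w_\gamma:G^d\to G$ by $w_\gamma(g_1,\ldots,g_d)=\gamma(w(g_1,\ldots,g_d))$. The group $G$ is called $\gamma$-chiral if there exist some $d$ and a word $w\in F_d$ such that the images of the maps $w$ and $w_\gamma$ are different. The group $G$ is called chiral if it is $\gamma$-chiral for the anti-automorphism $\gamma(g)=g^{-1}$, i.e. if there exist some $d$ and a word $w\in F_d$ such that the image $w(G^d)$ is not closed under inversion. *)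

theory Defs
  imports "HOL-Algebra.Group"
begin

text \<open>The letter \<open>(i, True)\<close> stands for the basis element $x_{i+1}$ and \<open>(i, False)\<close> for its
  inverse. Elements of the free group are represented by their reduced words.\<close>

type_synonym letter = "nat \<times> bool"

definition inv_letter :: "letter \<Rightarrow> letter" where
  "inv_letter a = (fst a, \<not> snd a)"

definition reduced :: "letter list \<Rightarrow> bool" where
  "reduced w \<longleftrightarrow> successively (\<lambda>a b. b \<noteq> inv_letter a) w"

fun cancel_cons :: "letter \<Rightarrow> letter list \<Rightarrow> letter list" where
  "cancel_cons a [] = [a]"
| "cancel_cons a (b # w) = (if b = inv_letter a then w else a # b # w)"

definition free_group :: "nat \<Rightarrow> letter list monoid" where
  "free_group d =
    \<lparr>carrier = {w. reduced w \<and> fst ` set w \<subseteq> {..<d}},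
     mult = (\<lambda>u v. foldr cancel_cons u v),
     one = []\<rparr>"

lemma inv_letter_inv_letter [simp]: "inv_letter (inv_letter a) = a"
  by (simp add: inv_letter_def)

lemma fst_inv_letter [simp]: "fst (inv_letter a) = fst a"
  by (simp add: inv_letter_def)

lemma inv_letter_neq [simp]: "inv_letter a \<noteq> a" "a \<noteq> inv_letter a"
  by (cases a; simp add: inv_letter_def)+

lemma reduced_simps [simp]:
  "reduced []" "reduced [a]"
  "reduced (a # b # w) \<longleftrightarrow> b \<noteq> inv_letter a \<and> reduced (b # w)"
  by (simp_all add: reduced_def)

lemma reduced_ConsD: "reduced (a # w) \<Longrightarrow> reduced w"
  by (cases w) auto

lemma reduced_cancel_cons: "reduced w \<Longrightarrow> reduced (cancel_cons a w)"
  by (cases w) (auto dest: reduced_ConsD)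

lemma reduced_foldr: "reduced w \<Longrightarrow> reduced (foldr cancel_cons u w)"
  by (induction u) (auto intro: reduced_cancel_cons)

lemma cancel_cons_reduced: "reduced (a # w) \<Longrightarrow> cancel_cons a w = a # w"
  by (cases w) auto

lemma cancel_cons_inverse:
  assumes "reduced w" shows "cancel_cons a (cancel_cons (inv_letter a) w) = w"
proof (cases w)
  case (Cons b v)
  then show ?thesis using assms by (cases v) auto
qed simp

lemma cancel_cons_inverse': "reduced w \<Longrightarrow> cancel_cons (inv_letter a) (cancel_cons a w) = w"
  using cancel_cons_inverse[of w "inv_letter a"] by simp

lemma foldr_cancel_cons_Cons:
  assumes "reduced w"
  shows "foldr cancel_cons (cancel_cons a v) w = cancel_cons a (foldr cancel_cons v w)"
  by (cases v) (auto simp: cancel_cons_inverse reduced_foldr assms)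

lemma foldr_cancel_cons_assoc:
  assumes "reduced w"
  shows "foldr cancel_cons (foldr cancel_cons u v) w = foldr cancel_cons u (foldr cancel_cons v w)"
  by (induction u) (simp_all add: foldr_cancel_cons_Cons assms)

lemma set_cancel_cons: "set (cancel_cons a w) \<subseteq> insert a (set w)"
  by (cases w) auto

lemma set_foldr_cancel_cons: "set (foldr cancel_cons u v) \<subseteq> set u \<union> set v"
  using set_cancel_cons by (induction u) fastforce+

lemma foldr_inverse: "foldr cancel_cons (rev (map inv_letter u)) u = []"
  by (induction u) auto

lemma reduced_inverse: "reduced u \<Longrightarrow> reduced (rev (map inv_letter u))"
proof -
  assume "reduced u"
  then have "successively (\<lambda>x y. inv_letter x \<noteq> y) u"
    unfolding reduced_def by (rule successively_mono) auto
  then have "successively (\<lambda>x y. inv_letter x \<noteq> inv_letter (inv_letter y)) u"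
    by simp
  then show ?thesis
    unfolding reduced_def successively_rev successively_map by simp
qed

theorem group_free_group: "group (free_group d)"
proof (rule groupI)
  fix u assume u: "u \<in> carrier (free_group d)"
  let ?v = "rev (map inv_letter u)"
  have "?v \<in> carrier (free_group d)"
    using u reduced_inverse[of u] by (auto simp: free_group_def)
  moreover have "?v \<otimes>\<^bsub>free_group d\<^esub> u = \<one>\<^bsub>free_group d\<^esub>"
    using foldr_inverse by (simp add: free_group_def)
  ultimately show "\<exists>v\<in>carrier (free_group d). v \<otimes>\<^bsub>free_group d\<^esub> u = \<one>\<^bsub>free_group d\<^esub>"
    by blast
next
  fix u v assume "u \<in> carrier (free_group d)" "v \<in> carrier (free_group d)"
  then show "u \<otimes>\<^bsub>free_group d\<^esub> v \<in> carrier (free_group d)"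
    using set_foldr_cancel_cons[of u v] reduced_foldr[of v u] by (fastforce simp: free_group_def)
qed (auto simp: free_group_def foldr_cancel_cons_assoc)

definition eval_letter :: "('a, 'b) monoid_scheme \<Rightarrow> (nat \<Rightarrow> 'a) \<Rightarrow> letter \<Rightarrow> 'a" where
  "eval_letter G g a = (if snd a then g (fst a) else inv\<^bsub>G\<^esub> g (fst a))"

text \<open>\<open>word_map G w g\<close> is the image of \<open>w\<close> under the homomorphism from the free group to \<open>G\<close>
  that sends the basis to \<open>g\<close>; see \<open>word_map_hom\<close>, \<open>word_map_basis\<close> and \<open>word_map_unique\<close>.\<close>

definition word_map :: "('a, 'b) monoid_scheme \<Rightarrow> letter list \<Rightarrow> (nat \<Rightarrow> 'a) \<Rightarrow> 'a" where
  "word_map G w g = foldr (\<lambda>a x. eval_letter G g a \<otimes>\<^bsub>G\<^esub> x) w \<one>\<^bsub>G\<^esub>"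

definition tuples :: "('a, 'b) monoid_scheme \<Rightarrow> nat \<Rightarrow> (nat \<Rightarrow> 'a) set" where
  "tuples G d = {..<d} \<rightarrow>\<^sub>E carrier G"

context group
begin

lemma eval_letter_closed:
  "g \<in> tuples G d \<Longrightarrow> fst a < d \<Longrightarrow> eval_letter G g a \<in> carrier G"
  by (auto simp: tuples_def eval_letter_def PiE_def Pi_def)

lemma word_map_closed:
  "g \<in> tuples G d \<Longrightarrow> fst ` set w \<subseteq> {..<d} \<Longrightarrow> word_map G w g \<in> carrier G"
  by (induction w) (auto simp: word_map_def intro!: m_closed eval_letter_closed)

lemma word_map_cancel_cons:
  assumes g: "g \<in> tuples G d" and a: "fst a < d" and w: "fst ` set w \<subseteq> {..<d}"
  shows "word_map G (cancel_cons a w) g = eval_letter G g a \<otimes> word_map G w g"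
proof (cases w)
  case (Cons b v)
  have v: "word_map G v g \<in> carrier G" using w Cons by (intro word_map_closed[OF g]) auto
  have gi: "g (fst a) \<in> carrier G" using g a by (auto simp: tuples_def)
  have "eval_letter G g a \<otimes> (eval_letter G g (inv_letter a) \<otimes> word_map G v g) = word_map G v g"
    using v gi by (auto simp: eval_letter_def inv_letter_def m_assoc[symmetric])
  then show ?thesis using Cons by (auto simp: word_map_def)
qed (simp add: word_map_def)

theorem word_map_hom:
  assumes g: "g \<in> tuples G d"
  shows "(\<lambda>w. word_map G w g) \<in> hom (free_group d) G"
proof (rule homI)
  fix u v assume "u \<in> carrier (free_group d)" "v \<in> carrier (free_group d)"
  then have u: "fst ` set u \<subseteq> {..<d}" and v: "fst ` set v \<subseteq> {..<d}"
    by (auto simp: free_group_def)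
  from u have "word_map G (foldr cancel_cons u v) g = word_map G u g \<otimes> word_map G v g"
  proof (induction u)
    case Nil
    then show ?case using word_map_closed[OF g v] by (simp add: word_map_def)
  next
    case (Cons a u)
    have "fst ` set (foldr cancel_cons u v) \<subseteq> {..<d}"
      using set_foldr_cancel_cons[of u v] Cons.prems v by fastforce
    then have "word_map G (foldr cancel_cons (a # u) v) g
        = eval_letter G g a \<otimes> (word_map G u g \<otimes> word_map G v g)"
      using Cons word_map_cancel_cons[OF g, of a] by simp
    also have "\<dots> = (eval_letter G g a \<otimes> word_map G u g) \<otimes> word_map G v g"
      using Cons.prems v by (intro m_assoc[symmetric] eval_letter_closed[OF g] word_map_closed[OF g]) auto
    finally show ?case by (simp add: word_map_def)
  qed
  then show "word_map G (u \<otimes>\<^bsub>free_group d\<^esub> v) g = word_map G u g \<otimes> word_map G v g"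
    by (simp add: free_group_def)
qed (auto simp: free_group_def intro: word_map_closed[OF g])

theorem word_map_basis:
  "g \<in> tuples G d \<Longrightarrow> i < d \<Longrightarrow> word_map G [(i, True)] g = g i"
  by (auto simp: word_map_def eval_letter_def tuples_def PiE_def Pi_def)

theorem word_map_unique:
  assumes g: "g \<in> tuples G d" and h: "h \<in> hom (free_group d) G"
    and basis: "\<And>i. i < d \<Longrightarrow> h [(i, True)] = g i"
    and w: "w \<in> carrier (free_group d)"
  shows "h w = word_map G w g"
proof -
  interpret F: group "free_group d" by (rule group_free_group)
  interpret H: group_hom "free_group d" G h
    using h by unfold_locales
  have letter: "h [a] = eval_letter G g a" if "fst a < d" for a
  proof (cases "snd a")
    case True
    then show ?thesis using basis[OF that] by (cases a) (auto simp: eval_letter_def)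
  next
    case False
    let ?x = "[(fst a, True)]"
    have x: "?x \<in> carrier (free_group d)" and a: "[a] \<in> carrier (free_group d)"
      using that by (auto simp: free_group_def)
    have "[a] \<otimes>\<^bsub>free_group d\<^esub> ?x = \<one>\<^bsub>free_group d\<^esub>"
      using False by (cases a) (auto simp: free_group_def inv_letter_def)
    then have "[a] = inv\<^bsub>free_group d\<^esub> ?x" using x a F.inv_equality by metis
    then show ?thesis using H.hom_inv[OF x] basis[OF that] False by (simp add: eval_letter_def)
  qed
  from w show ?thesis
  proof (induction w)
    case Nil
    then show ?case using H.hom_one by (simp add: word_map_def free_group_def)
  next
    case (Cons a w)
    have w: "w \<in> carrier (free_group d)" and a: "[a] \<in> carrier (free_group d)" "fst a < d"
      and r: "reduced (a # w)"
      using Cons.prems reduced_ConsD[of a w] by (auto simp: free_group_def)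
    have "a # w = [a] \<otimes>\<^bsub>free_group d\<^esub> w"
      using cancel_cons_reduced[OF r] by (simp add: free_group_def)
    then have "h (a # w) = h [a] \<otimes> h w" using H.hom_mult[OF a(1) w] by simp
    then show ?case using Cons.IH[OF w] letter[OF a(2)] by (simp add: word_map_def)
  qed
qed

end

definition anti_automorphism :: "('a, 'b) monoid_scheme \<Rightarrow> ('a \<Rightarrow> 'a) \<Rightarrow> bool" where
  "anti_automorphism G \<delta> \<longleftrightarrow>
     bij_betw \<delta> (carrier G) (carrier G) \<and>
     (\<forall>a\<in>carrier G. \<forall>b\<in>carrier G. \<delta> (a \<otimes>\<^bsub>G\<^esub> b) = \<delta> b \<otimes>\<^bsub>G\<^esub> \<delta> a)"

definition twisted_word_map ::
    "('a, 'b) monoid_scheme \<Rightarrow> ('a \<Rightarrow> 'a) \<Rightarrow> letter list \<Rightarrow> (nat \<Rightarrow> 'a) \<Rightarrow> 'a" where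
  "twisted_word_map G \<gamma> w g = \<gamma> (word_map G w g)"

definition chiral_wrt :: "('a, 'b) monoid_scheme \<Rightarrow> ('a \<Rightarrow> 'a) \<Rightarrow> bool" where
  "chiral_wrt G \<gamma> \<longleftrightarrow>
     (\<exists>d. \<exists>w\<in>carrier (free_group d).
        word_map G w ` tuples G d \<noteq> twisted_word_map G \<gamma> w ` tuples G d)"

definition chiral :: "('a, 'b) monoid_scheme \<Rightarrow> bool" where
  "chiral G \<longleftrightarrow> chiral_wrt G (\<lambda>g. inv\<^bsub>G\<^esub> g)"

context group
begin

lemma anti_automorphism_inv: "anti_automorphism G (\<lambda>g. inv g)"
  unfolding anti_automorphism_def
proof (intro conjI ballI)
  show "bij_betw (\<lambda>g. inv g) (carrier G) (carrier G)"
    by (rule bij_betwI[where g = "\<lambda>g. inv g"]) auto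
qed (simp add: inv_mult_group)

lemma chiral_iff_not_closed_under_inv:
  "chiral G \<longleftrightarrow>
     (\<exists>d. \<exists>w\<in>carrier (free_group d). \<exists>x\<in>word_map G w ` tuples G d. inv x \<notin> word_map G w ` tuples G d)"
proof -
  have "word_map G w ` tuples G d \<noteq> twisted_word_map G (\<lambda>g. inv g) w ` tuples G d \<longleftrightarrow>
      (\<exists>x\<in>word_map G w ` tuples G d. inv x \<notin> word_map G w ` tuples G d)" (is "?I \<noteq> _ \<longleftrightarrow> _")
    if "w \<in> carrier (free_group d)" for d w
  proof -
    have sub: "?I \<subseteq> carrier G"
      using that word_map_closed by (fastforce simp: free_group_def)
    have eq: "twisted_word_map G (\<lambda>g. inv g) w ` tuples G d = (\<lambda>x. inv x) ` ?I"
      by (auto simp: twisted_word_map_def)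
    have "?I = (\<lambda>x. inv x) ` ?I" if closed: "\<forall>x\<in>?I. inv x \<in> ?I"
    proof
      show "?I \<subseteq> (\<lambda>x. inv x) ` ?I"
      proof
        fix x assume x: "x \<in> ?I"
        then have "x = inv (inv x)" using sub by auto
        then show "x \<in> (\<lambda>x. inv x) ` ?I" using closed x by blast
      qed
    qed (use closed in blast)
    then show ?thesis unfolding eq by blast
  qed
  then show ?thesis unfolding chiral_def chiral_wrt_def by blast
qed

end

end

theory Submission
  imports Defs
begin

text \<open>The map $x \mapsto \gamma(x)^{-1}$ is an automorphism, and every automorphism preserves the
  image of every word map. Hence \<open>\<gamma>\<close> and inversion send this image to the same set.\<close>

context group
begin

text \<open>Evaluation at \<open>g\<close> followed by \<open>\<phi>\<close> is a homomorphism from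
  the free group that sends the basis to the values \<open>\<phi> (g i)\<close>, so the uniqueness
  in \<open>word_map_unique\<close> applies.\<close>

lemma iso_word_map:
  assumes \<phi>: "\<phi> \<in> iso G G" and g: "g \<in> tuples G d" and w: "w \<in> carrier (free_group d)"
  shows "\<phi> (word_map G w g) = word_map G w (restrict (\<phi> \<circ> g) {..<d})"
proof -
  have hom: "\<phi> \<in> hom G G" using \<phi> by (simp add: iso_def)
  \<comment> \<open>Tuples are extensional functions, so the composite must be reset to
    \<open>undefined\<close> outside \<open>{..<d}\<close>.\<close>
  have t: "restrict (\<phi> \<circ> g) {..<d} \<in> tuples G d"
    using g hom_in_carrier[OF hom] by (auto simp: tuples_def PiE_def Pi_def)
  have "(\<phi> \<circ> (\<lambda>w. word_map G w g)) w = word_map G w (restrict (\<phi> \<circ> g) {..<d})"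
    using Group.hom_compose[OF word_map_hom[OF g] hom] word_map_basis[OF g]
    by (intro word_map_unique[OF t _ _ w]) (auto simp: comp_def)
  then show ?thesis by simp
qed

lemma iso_image_word_map:
  assumes \<phi>: "\<phi> \<in> iso G G" and w: "w \<in> carrier (free_group d)"
  shows "\<phi> ` word_map G w ` tuples G d = word_map G w ` tuples G d" (is "\<phi> ` ?I = ?I")
proof -
  \<comment> \<open>Stated for every automorphism \<open>\<psi>\<close>, because it serves both for
    \<open>\<phi>\<close> and, in the reverse inclusion, for its inverse.\<close>
  have sub: "\<psi> ` ?I \<subseteq> ?I" if \<psi>: "\<psi> \<in> iso G G" for \<psi>
  proof -
    have "restrict (\<psi> \<circ> g) {..<d} \<in> tuples G d" if "g \<in> tuples G d" for g
      using that \<psi> by (auto simp: tuples_def iso_def hom_def)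
    then show ?thesis using iso_word_map[OF \<psi> _ w] by auto
  qed
  let ?\<psi> = "inv_into (carrier G) \<phi>"
  have I: "?I \<subseteq> carrier G"
    using w word_map_closed by (fastforce simp: free_group_def)
  have "?I \<subseteq> \<phi> ` ?I"
  proof
    fix x assume x: "x \<in> ?I"
    then have "x = \<phi> (?\<psi> x)"
      using I \<phi> by (auto simp: iso_def bij_betw_def f_inv_into_f)
    then show "x \<in> \<phi> ` ?I" using x sub[OF iso_set_sym[OF \<phi>]] by blast
  qed
  with sub[OF \<phi>] show ?thesis by (rule subset_antisym)
qed

text \<open>Both \<open>\<gamma>\<close> and inversion reverse products, so their composite
  preserves the order of factors.\<close>

lemma inv_anti_automorphism_iso:
  assumes "anti_automorphism G \<gamma>"
  shows "(\<lambda>x. inv (\<gamma> x)) \<in> iso G G"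
proof -
  have bij: "bij_betw \<gamma> (carrier G) (carrier G)"
    and anti: "\<And>a b. a \<in> carrier G \<Longrightarrow> b \<in> carrier G \<Longrightarrow> \<gamma> (a \<otimes> b) = \<gamma> b \<otimes> \<gamma> a"
    using assms by (auto simp: anti_automorphism_def)
  have cl: "\<gamma> x \<in> carrier G" if "x \<in> carrier G" for x
    using bij that by (auto simp: bij_betw_def)
  have "bij_betw ((\<lambda>x. inv x) \<circ> \<gamma>) (carrier G) (carrier G)"
    using anti_automorphism_inv bij_betw_trans[OF bij] by (auto simp: anti_automorphism_def)
  then show ?thesis
    by (auto simp: iso_def hom_def comp_def anti cl inv_mult_group)
qed

lemma twisted_word_map_image:
  assumes \<gamma>: "anti_automorphism G \<gamma>" and w: "w \<in> carrier (free_group d)"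
  shows "twisted_word_map G \<gamma> w ` tuples G d = twisted_word_map G (\<lambda>g. inv g) w ` tuples G d"
proof -
  let ?I = "word_map G w ` tuples G d"
  have "?I \<subseteq> carrier G"
    using w word_map_closed by (fastforce simp: free_group_def)
  then have "\<gamma> x \<in> carrier G" if "x \<in> ?I" for x
    using that \<gamma> by (auto simp: anti_automorphism_def bij_betw_def)
  \<comment> \<open>Inverting twice factors \<open>\<gamma>\<close> as the automorphism followed by
    inversion; the automorphism is then absorbed by \<open>?I\<close>.\<close>
  then have "\<gamma> ` ?I = (\<lambda>x. inv x) ` (\<lambda>x. inv (\<gamma> x)) ` ?I"
    unfolding image_image by (intro image_cong) auto
  also have "\<dots> = (\<lambda>x. inv x) ` ?I"
    by (simp only: iso_image_word_map[OF inv_anti_automorphism_iso[OF \<gamma>] w])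
  finally show ?thesis by (simp add: twisted_word_map_def image_image)
qed

end

theorem theorem4:
  fixes G :: "('a, 'b) monoid_scheme" and \<gamma> :: "'a \<Rightarrow> 'a"
  assumes "group G"
    and "anti_automorphism G \<gamma>"
  shows "chiral G \<longleftrightarrow> chiral_wrt G \<gamma>"
  \<comment> \<open>For each \<open>d\<close> and \<open>w\<close>, both sides compare the image of
    \<open>w\<close> with one and the same twisted image.\<close>
  using group.twisted_word_map_image[OF assms] by (simp add: chiral_def chiral_wrt_def)

end
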